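(* Let $\mathcal{H}$ be a complex Hilbert space and let $T\in\mathcal{B}(\mathcal{H})$. Then $$w^{2}(T)\leq\min\{\beta_1,\beta_2\},$$ where $$\beta_1=\min_{0\leq\alpha\leq 1}\left\{\frac{\alpha}{2}w(T^2)+\left\|\frac{\alpha}{4}|T|^{2}+\left(1-\frac{3}{4}\alpha\right)|T^*|^{2}\right\|\right\}$$ and $$\beta_2=\min_{0\leq\alpha\leq 1}\left\{\frac{\alpha}{2}w(T^2)+\left\|\left(1-\frac{3}{4}\alpha\right)|T|^{2}+\frac{\alpha}{4}|T^*|^{2}\right\|\right\}.$$
   Context: $\mathcal{B}(\mathcal{H})$ is the $C^*$-algebra of all bounded linear operators on the complex Hilbert space $\mathcal{H}$ with inner product $\langle\cdot,\cdot\rangle$; $\|\cdot\|$ is the operator norm and $T^*$ is the adjoint of $T$. $|T|=(T^*T)^{1/2}$ and $|T^*|=(TT^* )^{1/2}$. The numerical radius of $T$ is $w(T)=\sup\{|\langle Tx,x\rangle| : x\in\mathcal{H},\ \|x\|=1\}$, and $w^2(T)$ means $(w(T))^2$. *)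

theory Defs
  imports "HOL-Analysis.Analysis"
begin

text \<open>A complex inner product space is a real one (which provides the norm and the topology) with
  compatible complex structure. The complex inner product is linear in its first argument;
  that it is positive definite and induces the norm follows from the last axiom.\<close>

class complex_inner = real_inner +
  fixes scaleC :: "complex \<Rightarrow> 'a \<Rightarrow> 'a"  (infixr \<open>*\<^sub>C\<close> 75)
    and cinner :: "'a \<Rightarrow> 'a \<Rightarrow> complex"
  assumes scaleC_add_right: "c *\<^sub>C (x + y) = c *\<^sub>C x + c *\<^sub>C y"
    and scaleC_add_left: "(c + d) *\<^sub>C x = c *\<^sub>C x + d *\<^sub>C x"
    and scaleC_scaleC: "c *\<^sub>C d *\<^sub>C x = (c * d) *\<^sub>C x"
    and scaleC_complex_of_real: "complex_of_real r *\<^sub>C x = r *\<^sub>R x"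
    and cinner_commute: "cinner x y = cnj (cinner y x)"
    and cinner_add_left: "cinner (x + y) z = cinner x z + cinner y z"
    and cinner_scaleC_left: "cinner (c *\<^sub>C x) y = c * cinner x y"
    and inner_eq_Re_cinner: "inner x y = Re (cinner x y)"

class chilbert_space = complex_inner + complete_space

text \<open>\<open>B(H)\<close>, inside the library type of bounded real-linear operators. The norm inherited from
  that type is the operator norm.\<close>

definition bounded_ops :: "('a::chilbert_space \<Rightarrow>\<^sub>L 'a) set"
  where "bounded_ops = {T. \<forall>c x. blinfun_apply T (c *\<^sub>C x) = c *\<^sub>C blinfun_apply T x}"

definition adj :: "('a::chilbert_space \<Rightarrow>\<^sub>L 'a) \<Rightarrow> 'a \<Rightarrow>\<^sub>L 'a"
  where "adj T = (THE S. \<forall>x y. cinner (blinfun_apply T x) y = cinner x (blinfun_apply S y))"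

definition positive_op :: "('a::chilbert_space \<Rightarrow>\<^sub>L 'a) \<Rightarrow> bool"
  where "positive_op A \<longleftrightarrow> A \<in> bounded_ops \<and> (\<forall>x. cinner (blinfun_apply A x) x \<in> \<real>\<^sub>\<ge>\<^sub>0)"

definition op_sqrt :: "('a::chilbert_space \<Rightarrow>\<^sub>L 'a) \<Rightarrow> 'a \<Rightarrow>\<^sub>L 'a"
  where "op_sqrt A = (THE S. positive_op S \<and> S o\<^sub>L S = A)"

definition op_abs :: "('a::chilbert_space \<Rightarrow>\<^sub>L 'a) \<Rightarrow> 'a \<Rightarrow>\<^sub>L 'a"
  where "op_abs T = op_sqrt (adj T o\<^sub>L T)"

definition op_square :: "('a::chilbert_space \<Rightarrow>\<^sub>L 'a) \<Rightarrow> 'a \<Rightarrow>\<^sub>L 'a"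
  where "op_square A = A o\<^sub>L A"

text \<open>The inserted \<open>0\<close> only matters for the zero space, which has no unit vectors: there it
  gives the numerical radius \<open>0\<close>, whereas \<open>Sup {}\<close> is unspecified on \<open>real\<close>.\<close>

definition numerical_radius :: "('a::chilbert_space \<Rightarrow>\<^sub>L 'a) \<Rightarrow> real"
  where "numerical_radius T =
    Sup (insert 0 {cmod (cinner (blinfun_apply T x) x) | x. norm x = 1})"

text \<open>\<open>LEAST\<close> is the minimum of a set of reals, rather than its infimum; it exists here by
  continuity in \<open>\<alpha>\<close> and compactness of \<open>{0..1}\<close>.\<close>

definition beta1 :: "('a::chilbert_space \<Rightarrow>\<^sub>L 'a) \<Rightarrow> real"
  where "beta1 T = (LEAST b. b \<in> (\<lambda>\<alpha>. \<alpha> / 2 * numerical_radius (op_square T)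
      + norm ((\<alpha> / 4) *\<^sub>R op_square (op_abs T)
            + (1 - 3 / 4 * \<alpha>) *\<^sub>R op_square (op_abs (adj T)))) ` {0..1})"

definition beta2 :: "('a::chilbert_space \<Rightarrow>\<^sub>L 'a) \<Rightarrow> real"
  where "beta2 T = (LEAST b. b \<in> (\<lambda>\<alpha>. \<alpha> / 2 * numerical_radius (op_square T)
      + norm ((1 - 3 / 4 * \<alpha>) *\<^sub>R op_square (op_abs T)
            + (\<alpha> / 4) *\<^sub>R op_square (op_abs (adj T)))) ` {0..1})"

end

theory Submission imports Defs begin

text \<open>
  Fix a unit vector \<open>x\<close>. Two bounds on \<open>|\<langle>Tx,x\<rangle>|\<^sup>2\<close> are available. Cauchy-Schwarz gives
  \<open>|\<langle>Tx,x\<rangle>|\<^sup>2 \<le> \<parallel>T\<^sup>*x\<parallel>\<^sup>2 = \<langle>|T\<^sup>*|\<^sup>2x,x\<rangle>\<close>, and likewise with \<open>\<parallel>Tx\<parallel>\<^sup>2 = \<langle>|T|\<^sup>2x,x\<rangle>\<close>. Buzano's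
  refinement of Cauchy-Schwarz, applied to \<open>Tx\<close> and \<open>T\<^sup>*x\<close>, gives
  \<open>|\<langle>Tx,x\<rangle>|\<^sup>2 \<le> |\<langle>T\<^sup>2x,x\<rangle>|/2 + \<parallel>Tx\<parallel>\<parallel>T\<^sup>*x\<parallel>/2\<close>, hence by the arithmetic-geometric mean inequality
  \<open>|\<langle>Tx,x\<rangle>|\<^sup>2 \<le> |\<langle>T\<^sup>2x,x\<rangle>|/2 + (\<parallel>Tx\<parallel>\<^sup>2 + \<parallel>T\<^sup>*x\<parallel>\<^sup>2)/4\<close>. The convex combination of the Buzano bound
  (weight \<open>\<alpha>\<close>) and the Cauchy-Schwarz bound (weight \<open>1 - \<alpha>\<close>) is
  \<open>\<alpha>/2 |\<langle>T\<^sup>2x,x\<rangle>|\<close> plus the quadratic form of \<open>\<alpha>/4 |T|\<^sup>2 + (1 - 3\<alpha>/4) |T\<^sup>*|\<^sup>2\<close> at \<open>x\<close>; the supremum over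
  \<open>x\<close> is the estimate for one \<open>\<alpha>\<close>. The least value over \<open>\<alpha> \<in> [0,1]\<close> is attained by compactness, so it is
  one of these estimates.

  What this argument presupposes has to be established for an arbitrary complex Hilbert space: that
  adjoints exist (Riesz representation, by minimising \<open>\<parallel>x\<parallel>\<^sup>2 - 2 f(x)\<close>), and that a positive operator
  has exactly one positive square root, so that \<open>|T|\<^sup>2 = T\<^sup>*T\<close>. The square root of \<open>1 - B\<close>, where
  \<open>\<parallel>B\<parallel> \<le> 1\<close>, is \<open>1 - Y\<close> for a solution of \<open>Y = (B + Y\<^sup>2)/2\<close>; the fixed-point iteration for \<open>Y\<close>
  converges in norm because it is dominated by the same iteration on the real number \<open>1\<close>.
\<close>

section \<open>Complex inner products\<close>

lemma cinner_add_right: "cinner x (y + z) = cinner x y + cinner x (z::'a::complex_inner)"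
  by (metis cinner_add_left cinner_commute complex_cnj_add)

lemma cinner_scaleC_right: "cinner x (c *\<^sub>C y) = cnj c * cinner x (y::'a::complex_inner)"
  by (metis cinner_commute cinner_scaleC_left complex_cnj_mult)

lemma cinner_scaleR_left: "cinner (r *\<^sub>R x) y = r * cinner x (y::'a::complex_inner)"
  by (metis cinner_scaleC_left scaleC_complex_of_real)

lemma cinner_minus_left: "cinner (- x) y = - cinner x (y::'a::complex_inner)"
  using cinner_scaleR_left[of "-1" x y] by simp

lemma cinner_diff_left: "cinner (x - y) z = cinner x z - cinner y (z::'a::complex_inner)"
  using cinner_add_left[of x "- y" z] by (simp add: cinner_minus_left)

text \<open>The real inner product determines the complex one, so that facts about real-linear operators on
  the underlying real Hilbert space carry over.\<close>

lemma Im_cinner: "Im (cinner x y) = inner x (\<i> *\<^sub>C (y::'a::complex_inner))"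
  by (simp add: inner_eq_Re_cinner cinner_scaleC_right)

lemma cinner_eq_iff:
  fixes x :: "'a::complex_inner"
  shows "cinner x y = cinner u v \<longleftrightarrow> inner x y = inner u v \<and> inner x (\<i> *\<^sub>C y) = inner u (\<i> *\<^sub>C v)"
  by (simp add: complex_eq_iff Im_cinner inner_eq_Re_cinner)

lemma inner_scaleC_left: "inner (c *\<^sub>C x) y = inner x (cnj c *\<^sub>C (y::'a::complex_inner))"
  by (simp add: inner_eq_Re_cinner cinner_scaleC_right cinner_scaleC_left)

lemma cinner_self: "cinner x x = complex_of_real ((norm (x::'a::complex_inner))\<^sup>2)"
proof -
  have "Im (cinner x x) = 0"
    using cinner_commute[of x x] by (simp add: complex_eq_iff)
  then show ?thesis
    by (simp add: complex_eq_iff power2_norm_eq_inner inner_eq_Re_cinner)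
qed

lemma norm_scaleC: "norm (c *\<^sub>C x) = cmod c * norm (x::'a::complex_inner)"
proof -
  have "complex_of_real ((norm (c *\<^sub>C x))\<^sup>2) = complex_of_real ((cmod c * norm x)\<^sup>2)"
    by (simp add: cinner_self[symmetric] cinner_scaleC_left cinner_scaleC_right power_mult_distrib
        complex_norm_square mult.assoc del: of_real_power)
  then show ?thesis
    by (metis of_real_eq_iff norm_ge_zero power2_eq_iff_nonneg zero_le_mult_iff)
qed

text \<open>Rotating \<open>x\<close> so that \<open>\<langle>x,y\<rangle>\<close> becomes real reduces this to the real Cauchy-Schwarz inequality.\<close>

lemma complex_Cauchy_Schwarz: "cmod (cinner x y) \<le> norm x * norm (y::'a::complex_inner)"
proof (cases "cinner x y = 0")
  case False
  define c where "c = cnj (cinner x y) / cmod (cinner x y)"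
  have "cmod c = 1"
    using False by (simp add: c_def norm_divide)
  have "c * cinner x y = cmod (cinner x y)"
    using False complex_norm_square[of "cinner x y"]
    by (simp add: c_def field_simps power2_eq_square)
  then have "cmod (cinner x y) = inner (c *\<^sub>C x) y"
    by (simp add: inner_eq_Re_cinner cinner_scaleC_left)
  also have "\<dots> \<le> norm (c *\<^sub>C x) * norm y"
    by (rule norm_cauchy_schwarz)
  finally show ?thesis
    using \<open>cmod c = 1\<close> by (simp add: norm_scaleC)
qed simp

text \<open>Buzano's inequality: \<open>2 \<langle>a,e\<rangle> e - a\<close> is the reflection of \<open>a\<close> in the line spanned by \<open>e\<close>, so it has
  the norm of \<open>a\<close>, and Cauchy-Schwarz applies to it and \<open>b\<close>.\<close>

lemma Buzano:
  fixes a b e :: "'a::complex_inner"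
  assumes "norm e = 1"
  shows "2 * cmod (cinner a e * cinner e b) \<le> cmod (cinner a b) + norm a * norm b"
proof -
  define r where "r = (2 * cinner a e) *\<^sub>C e - a"
  have "(norm r)\<^sup>2 = (norm ((2 * cinner a e) *\<^sub>C e))\<^sup>2 + (norm a)\<^sup>2 - 2 * inner ((2 * cinner a e) *\<^sub>C e) a"
    unfolding r_def by (simp add: power2_norm_eq_inner algebra_simps inner_commute)
  also have "inner ((2 * cinner a e) *\<^sub>C e) a = 2 * (cmod (cinner a e))\<^sup>2"
    unfolding cmod_power2 using cinner_commute[of e a]
    by (simp add: inner_eq_Re_cinner cinner_scaleC_left power2_eq_square)
  finally have "(norm r)\<^sup>2 = (norm a)\<^sup>2"
    using assms by (simp add: norm_scaleC norm_mult power_mult_distrib)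
  then have "norm r = norm a"
    by simp
  have "2 * cinner a e * cinner e b = cinner a b + cinner r b"
    by (simp add: r_def cinner_diff_left cinner_scaleC_left)
  then have "2 * cmod (cinner a e * cinner e b) = cmod (cinner a b + cinner r b)"
    by (metis norm_mult norm_numeral mult.assoc)
  also have "\<dots> \<le> cmod (cinner a b) + cmod (cinner r b)"
    by (rule norm_triangle_ineq)
  also have "cmod (cinner r b) \<le> norm a * norm b"
    using complex_Cauchy_Schwarz[of r b] \<open>norm r = norm a\<close> by simp
  finally show ?thesis by simp
qed

section \<open>Riesz representation and adjoints\<close>

instance chilbert_space \<subseteq> banach ..

text \<open>The representing vector is the minimiser of \<open>J x = \<parallel>x\<parallel>\<^sup>2 - 2 f(x)\<close>. By the parallelogram law a
  minimising sequence is Cauchy, and the first variation of \<open>J\<close> at its limit \<open>z\<close> is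
  \<open>2 (\<langle>v,z\<rangle> - f(v))\<close>.\<close>

theorem Riesz_representation:
  fixes f :: "'a::{real_inner,complete_space} \<Rightarrow> real"
  assumes "bounded_linear f"
  obtains z where "\<And>x. f x = inner x z"
proof -
  interpret f: bounded_linear f by fact
  define J where "J x = (norm x)\<^sup>2 - 2 * f x" for x
  obtain K where K: "\<And>x. norm (f x) \<le> norm x * K"
    using f.bounded by blast
  have below: "- K\<^sup>2 \<le> J x" for x
  proof -
    have "0 \<le> (norm x - K)\<^sup>2" by simp
    then have "2 * (norm x * K) \<le> (norm x)\<^sup>2 + K\<^sup>2"
      by (simp add: power2_diff)
    moreover have "f x \<le> norm x * K"
      using K[of x] by simp
    ultimately show ?thesis
      unfolding J_def by linarith
  qed
  define m where "m = Inf (range J)"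
  have bdd: "bdd_below (range J)"
    using below by (intro bdd_belowI[of _ "- K\<^sup>2"]) auto
  have m_le: "m \<le> J x" for x
    unfolding m_def by (rule cInf_lower[OF _ bdd]) simp
  have "\<exists>x. J x < m + 1 / Suc n" for n
    using cInf_lessD[of "range J" "m + 1 / Suc n"] by (auto simp: m_def)
  then obtain X where X: "\<And>n. J (X n) < m + 1 / Suc n"
    by metis
  have gap: "(dist (X k) (X n))\<^sup>2 \<le> 2 / Suc k + 2 / Suc n" for k n
  proof -
    have "(dist (X k) (X n))\<^sup>2 = 2 * J (X k) + 2 * J (X n) - 4 * J ((1/2) *\<^sub>R (X k + X n))"
      unfolding J_def dist_norm
      by (simp add: power2_norm_eq_inner f.add f.scaleR algebra_simps inner_commute)
    moreover have "2 / real (Suc i) = 2 * (1 / real (Suc i))" for i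
      by simp
    ultimately show ?thesis
      using X[of k] X[of n] m_le[of "(1/2) *\<^sub>R (X k + X n)"] by linarith
  qed
  have "Cauchy X"
  proof (rule metric_CauchyI)
    fix e :: real assume "0 < e"
    then obtain N where N: "4 / e\<^sup>2 < real (Suc N)"
      using reals_Archimedean2 less_trans of_nat_less_iff lessI by meson
    have "dist (X k) (X n) < e" if "N \<le> k" "N \<le> n" for k n
    proof -
      have "2 / Suc k + 2 / Suc n \<le> 2 / Suc N + 2 / Suc N"
        using that by (intro add_mono divide_left_mono) auto
      also have "\<dots> = 4 / Suc N"
        by simp
      also have "\<dots> < e\<^sup>2"
        using N \<open>0 < e\<close> by (simp add: field_simps)
      finally have "(dist (X k) (X n))\<^sup>2 < e\<^sup>2"
        using gap[of k n] by linarith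
      then show ?thesis
        using \<open>0 < e\<close> by (simp add: power_less_imp_less_base)
    qed
    then show "\<exists>M. \<forall>k\<ge>M. \<forall>n\<ge>M. dist (X k) (X n) < e"
      by blast
  qed
  then obtain z where z: "X \<longlonglongrightarrow> z"
    using Cauchy_convergent_iff convergent_def by blast
  have "(\<lambda>n. J (X n)) \<longlonglongrightarrow> J z"
    unfolding J_def by (intro tendsto_intros z f.tendsto)
  moreover have "(\<lambda>n. m + 1 / real (Suc n)) \<longlonglongrightarrow> m + 0"
    using LIMSEQ_inverse_real_of_nat by (intro tendsto_intros) (simp add: inverse_eq_divide)
  ultimately have "J z \<le> m + 0"
    by (rule LIMSEQ_le) (use X less_imp_le in blast)
  then have minimal: "J z \<le> J x" for x
    using m_le[of x] by simp
  have "f v = inner v z" for v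
  proof (cases "v = 0")
    case True
    then show ?thesis by (simp add: f.zero)
  next
    case False
    define d where "d = f v - inner v z"
    define t where "t = d / (norm v)\<^sup>2"
    \<comment> \<open>\<open>t\<close> minimises the quadratic polynomial \<open>J (z + t v) - J z = t\<^sup>2 \<parallel>v\<parallel>\<^sup>2 - 2 t d\<close>.\<close>
    have "J (z + t *\<^sub>R v) = J z + t\<^sup>2 * (norm v)\<^sup>2 - 2 * t * d"
      unfolding J_def d_def power2_norm_eq_inner
      by (simp add: f.add f.scaleR algebra_simps inner_commute power2_eq_square)
    also have "\<dots> = J z - d\<^sup>2 / (norm v)\<^sup>2"
      using False by (simp add: t_def power2_eq_square field_simps)
    finally have "d\<^sup>2 / (norm v)\<^sup>2 \<le> 0"
      using minimal[of "z + t *\<^sub>R v"] by linarith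
    then show ?thesis
      using False by (simp add: d_def divide_le_0_iff)
  qed
  then show thesis
    using that by blast
qed

lemma real_adjoint_exists:
  fixes T :: "'a::{real_inner,complete_space} \<Rightarrow>\<^sub>L 'a"
  obtains S :: "'a \<Rightarrow>\<^sub>L 'a" where "\<And>x y. inner (T x) y = inner x (S y)"
proof -
  have "bounded_linear (\<lambda>x. inner (T x) y)" for y
    by (intro bounded_linear_intros)
  then have "\<exists>z. \<forall>x. inner (T x) y = inner x z" for y
    by (metis Riesz_representation)
  then obtain s where s: "\<And>x y. inner (T x) y = inner x (s y)"
    by metis
  have eqI: "u = v" if "\<And>x. inner x u = inner x v" for u v :: 'a
    using that[of "u - v"] by (metis inner_diff_right inner_eq_zero_iff right_minus_eq)
  have "bounded_linear s"
  proof (rule bounded_linear_intro)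
    show "s (x + y) = s x + s y" for x y
      by (rule eqI) (simp add: s[symmetric] inner_add_right)
    show "s (r *\<^sub>R x) = r *\<^sub>R s x" for r x
      by (rule eqI) (simp add: s[symmetric])
    show "norm (s y) \<le> norm y * norm T" for y
    proof (cases "s y = 0")
      case False
      have "norm (s y) * norm (s y) = inner (T (s y)) y"
        by (simp add: s flip: power2_norm_eq_inner power2_eq_square)
      also have "\<dots> \<le> norm (T (s y)) * norm y"
        by (rule norm_cauchy_schwarz)
      also have "\<dots> \<le> norm T * norm (s y) * norm y"
        by (intro mult_right_mono norm_blinfun) simp
      finally show ?thesis
        using False by (simp add: field_simps)
    qed simp
  qed
  then show thesis
    using that[of "Blinfun s"] s by (simp add: bounded_linear_Blinfun_apply)
qed

lemma bounded_opsD: "T \<in> bounded_ops \<Longrightarrow> T (c *\<^sub>C x) = c *\<^sub>C T x"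
  by (simp add: bounded_ops_def)

lemma adj_eqI:
  fixes T S :: "'a::chilbert_space \<Rightarrow>\<^sub>L 'a"
  assumes "\<And>x y. cinner (T x) y = cinner x (S y)"
  shows "adj T = S"
  unfolding adj_def
proof (rule the_equality)
  fix R :: "'a \<Rightarrow>\<^sub>L 'a"
  assume R: "\<forall>x y. cinner (T x) y = cinner x (R y)"
  show "R = S"
  proof (rule blinfun_eqI)
    fix y
    have "inner x (R y) = inner x (S y)" for x
      using R assms by (metis inner_eq_Re_cinner)
    from this[of "R y - S y"] show "R y = S y"
      by (metis inner_diff_right inner_eq_zero_iff right_minus_eq)
  qed
qed (use assms in blast)

text \<open>The adjoint for the real inner product is the complex adjoint, because \<open>T\<close> commutes with \<open>\<i>\<close> and the
  adjoint of multiplication by \<open>\<i>\<close> is multiplication by \<open>-\<i>\<close>.\<close>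

lemma cinner_adj:
  fixes T :: "'a::chilbert_space \<Rightarrow>\<^sub>L 'a"
  assumes "T \<in> bounded_ops"
  shows "cinner (T x) y = cinner x (adj T y)"
proof -
  obtain S :: "'a \<Rightarrow>\<^sub>L 'a" where S: "\<And>x y. inner (T x) y = inner x (S y)"
    using real_adjoint_exists by blast
  have "inner (T x) (\<i> *\<^sub>C y) = inner x (\<i> *\<^sub>C S y)" for x y
    using bounded_opsD[OF assms, of "-\<i>" x] S[of "(-\<i>) *\<^sub>C x" y]
      inner_scaleC_left[of "-\<i>" "T x" y] inner_scaleC_left[of "-\<i>" x "S y"] by simp
  then have S_adj: "\<And>x y. cinner (T x) y = cinner x (S y)"
    by (simp add: cinner_eq_iff S)
  then have "adj T = S"
    by (rule adj_eqI)
  with S_adj show ?thesis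
    by simp
qed

lemma cinner_adj_left:
  assumes "T \<in> bounded_ops"
  shows "cinner (adj T x) y = cinner x (T y)"
  by (metis assms cinner_adj cinner_commute)

lemma adj_in_bounded_ops:
  assumes "T \<in> bounded_ops"
  shows "adj T \<in> bounded_ops"
  unfolding bounded_ops_def
proof (safe)
  fix c x
  let ?d = "adj T (c *\<^sub>C x) - c *\<^sub>C adj T x"
  have "cinner (adj T (c *\<^sub>C x)) y = cinner (c *\<^sub>C adj T x) y" for y
    by (simp add: cinner_adj_left[OF assms] cinner_scaleC_left)
  then have "cinner ?d ?d = 0"
    by (simp add: cinner_diff_left)
  then show "adj T (c *\<^sub>C x) = c *\<^sub>C adj T x"
    by (simp add: cinner_self)
qed

lemma adj_adj: "T \<in> bounded_ops \<Longrightarrow> adj (adj T) = T"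
  by (rule adj_eqI) (rule cinner_adj_left)

section \<open>Positive operators\<close>

text \<open>On a complex space a real quadratic form has a Hermitian sesquilinear form: compare its values
  at \<open>x + y\<close> and \<open>x + \<i> y\<close>.\<close>

lemma positive_op_hermitian:
  assumes "positive_op S"
  shows "cinner (S x) y = cinner x (S y)"
proof -
  have real: "Im (cinner (S v) v) = 0" for v
    using assms by (auto simp: positive_op_def complex_nonneg_Reals_iff)
  have S: "S (c *\<^sub>C v) = c *\<^sub>C S v" for c v
    using assms by (simp add: positive_op_def bounded_opsD)
  note expand = blinfun.add_right S cinner_add_left cinner_add_right cinner_scaleC_left
    cinner_scaleC_right
  have "Im (cinner (S x) y) + Im (cinner (S y) x) = 0"
    using real[of "x + y"] real[of x] real[of y] by (simp add: expand)
  moreover have "Re (cinner (S y) x) - Re (cinner (S x) y) = 0"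
    using real[of "x + \<i> *\<^sub>C y"] real[of x] real[of y] by (simp add: expand)
  ultimately have "cinner (S x) y = cnj (cinner (S y) x)"
    by (simp add: complex_eq_iff)
  then show ?thesis
    using cinner_commute[of x "S y"] by simp
qed

lemma positive_op_symmetric:
  assumes "positive_op S"
  shows "inner (S x) y = inner x (S y)"
  by (simp add: inner_eq_Re_cinner positive_op_hermitian[OF assms])

lemma positive_op_nonneg:
  assumes "positive_op S"
  shows "0 \<le> inner (S x) x"
  using assms by (auto simp: positive_op_def inner_eq_Re_cinner complex_nonneg_Reals_iff)

text \<open>Conversely, symmetry for the real inner product makes the complex quadratic form real.\<close>

lemma positive_opI:
  assumes S: "S \<in> bounded_ops"
    and sym: "\<And>x y. inner (S x) y = inner x (S y)"
    and nonneg: "\<And>x. 0 \<le> inner (S x) x"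
  shows "positive_op S"
proof -
  have "Im (cinner (S x) x) = 0" for x
  proof -
    have "inner (S x) (\<i> *\<^sub>C x) = inner x (\<i> *\<^sub>C S x)"
      by (simp add: sym bounded_opsD[OF S])
    also have "\<dots> = - inner (\<i> *\<^sub>C x) (S x)"
      by (simp add: inner_eq_Re_cinner cinner_scaleC_left cinner_scaleC_right)
    finally show ?thesis
      by (simp add: Im_cinner inner_commute)
  qed
  then show ?thesis
    using S nonneg by (simp add: positive_op_def complex_nonneg_Reals_iff inner_eq_Re_cinner)
qed

text \<open>An operator version of \<open>a\<^sup>2 \<le> \<parallel>a\<parallel> a\<close>: evaluate the quadratic form at \<open>cx - Ax\<close>.\<close>

lemma positive_op_norm_le:
  assumes A: "positive_op A" and c: "norm A \<le> c" "0 < c"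
  shows "(norm (A x))\<^sup>2 \<le> c * inner (A x) x"
proof -
  have AA: "inner (A (A x)) (A x) \<le> c * (norm (A x))\<^sup>2"
  proof -
    have "inner (A (A x)) (A x) \<le> norm (A (A x)) * norm (A x)"
      by (rule norm_cauchy_schwarz)
    also have "\<dots> \<le> (norm A * norm (A x)) * norm (A x)"
      by (intro mult_right_mono norm_blinfun) simp
    also have "\<dots> \<le> (c * norm (A x)) * norm (A x)"
      using c by (intro mult_right_mono) auto
    finally show ?thesis by (simp add: power2_eq_square)
  qed
  have "0 \<le> inner (A (c *\<^sub>R x - A x)) (c *\<^sub>R x - A x)"
    by (rule positive_op_nonneg[OF A])
  also have "\<dots> = c\<^sup>2 * inner (A x) x - 2 * c * (norm (A x))\<^sup>2 + inner (A (A x)) (A x)"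
    unfolding power2_norm_eq_inner using positive_op_symmetric[OF A, of "A x" x]
    by (simp add: blinfun.diff_right blinfun.scaleR_right inner_diff_left inner_diff_right
        inner_commute algebra_simps power2_eq_square)
  finally have "0 \<le> c * (c * inner (A x) x - (norm (A x))\<^sup>2)"
    using AA by (simp add: algebra_simps power2_eq_square)
  then show ?thesis
    using c by (simp add: zero_le_mult_iff)
qed

lemma positive_op_kernel:
  assumes "positive_op A" "inner (A x) x = 0"
  shows "A x = 0"
  using positive_op_norm_le[OF assms(1), of "norm A + 1" x] assms(2)
  by (simp add: add_nonneg_pos)

section \<open>Square roots of positive operators\<close>

fun sqrt_iter :: "('a::real_normed_vector \<Rightarrow>\<^sub>L 'a) \<Rightarrow> nat \<Rightarrow> 'a \<Rightarrow>\<^sub>L 'a" where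
  "sqrt_iter B 0 = 0"
| "sqrt_iter B (Suc n) = (1/2) *\<^sub>R (B + (sqrt_iter B n o\<^sub>L sqrt_iter B n))"

text \<open>The same iteration for the number \<open>1\<close> in place of \<open>B\<close>. It is increasing and bounded by \<open>1\<close>, so
  it converges, and its increments bound those of the operator iteration.\<close>

fun sqrt_majorant :: "nat \<Rightarrow> real" where
  "sqrt_majorant 0 = 0"
| "sqrt_majorant (Suc n) = (1 + (sqrt_majorant n)\<^sup>2) / 2"

lemma sqrt_majorant_bounds: "0 \<le> sqrt_majorant n \<and> sqrt_majorant n \<le> 1"
  by (induction n) (auto simp: power_le_one)

lemma norm_sqrt_iter:
  assumes "norm B \<le> 1"
  shows "norm (sqrt_iter B n) \<le> sqrt_majorant n"
proof (induction n)
  case (Suc n)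
  have "norm (sqrt_iter B n o\<^sub>L sqrt_iter B n) \<le> norm (sqrt_iter B n) * norm (sqrt_iter B n)"
    by (rule norm_blinfun_compose)
  also have "\<dots> \<le> (sqrt_majorant n)\<^sup>2"
    using Suc sqrt_majorant_bounds[of n] by (simp add: power2_eq_square mult_mono)
  finally have "norm (B + (sqrt_iter B n o\<^sub>L sqrt_iter B n)) \<le> 1 + (sqrt_majorant n)\<^sup>2"
    using assms norm_triangle_ineq[of B "sqrt_iter B n o\<^sub>L sqrt_iter B n"] by linarith
  then show ?case by simp
qed simp

text \<open>With \<open>X = Y\<^sub>n\<close> and \<open>Z = Y\<^sub>n\<^sub>+\<^sub>1\<close>, the identity \<open>Z\<^sup>2 - X\<^sup>2 = Z(Z - X) + (Z - X)X\<close> passes the domination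
  on to the next increment: for the majorant it reads \<open>z\<^sup>2 - x\<^sup>2 = z(z - x) + (z - x)x\<close>, with nonnegative
  factors throughout.\<close>

lemma norm_sqrt_iter_increment:
  assumes "norm B \<le> 1"
  shows "norm (sqrt_iter B (Suc n) - sqrt_iter B n) \<le> sqrt_majorant (Suc n) - sqrt_majorant n"
proof (induction n)
  case 0
  show ?case using assms by simp
next
  case (Suc n)
  define X Z where "X = sqrt_iter B n" and "Z = sqrt_iter B (Suc n)"
  define x z where "x = sqrt_majorant n" and "z = sqrt_majorant (Suc n)"
  have XZ: "norm X \<le> x" "norm Z \<le> z" "norm (Z - X) \<le> z - x"
    using norm_sqrt_iter[OF assms] Suc by (simp_all only: X_def Z_def x_def z_def)
  have "0 \<le> x" "0 \<le> z"
    using sqrt_majorant_bounds by (simp_all only: x_def z_def)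
  have split: "(Z o\<^sub>L Z) - (X o\<^sub>L X) = (Z o\<^sub>L (Z - X)) + ((Z - X) o\<^sub>L X)"
    by (rule blinfun_eqI) (simp add: blinfun.bilinear_simps)
  have "norm ((Z o\<^sub>L Z) - (X o\<^sub>L X)) \<le> norm Z * norm (Z - X) + norm (Z - X) * norm X"
    unfolding split by (intro norm_triangle_mono norm_blinfun_compose)
  also have "\<dots> \<le> z * (z - x) + (z - x) * x"
    using XZ \<open>0 \<le> x\<close> \<open>0 \<le> z\<close> order_trans[OF norm_ge_zero XZ(3)]
    by (intro add_mono mult_mono) auto
  finally have main: "norm ((Z o\<^sub>L Z) - (X o\<^sub>L X)) \<le> z\<^sup>2 - x\<^sup>2"
    by (simp add: power2_eq_square algebra_simps)
  have "sqrt_iter B (Suc (Suc n)) - sqrt_iter B (Suc n) = (1/2) *\<^sub>R ((Z o\<^sub>L Z) - (X o\<^sub>L X))"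
    unfolding sqrt_iter.simps(2)[of B "Suc n"] Z_def[symmetric]
    by (simp add: Z_def X_def algebra_simps flip: scaleR_add_right scaleR_diff_right)
  moreover have "sqrt_majorant (Suc (Suc n)) - sqrt_majorant (Suc n) = (z\<^sup>2 - x\<^sup>2) / 2"
    unfolding sqrt_majorant.simps(2)[of "Suc n"] z_def[symmetric]
    by (simp add: z_def x_def field_simps)
  ultimately show ?case
    using main by simp
qed

lemma norm_sqrt_iter_diff:
  assumes "norm B \<le> 1"
  shows "norm (sqrt_iter B (n + k) - sqrt_iter B n) \<le> sqrt_majorant (n + k) - sqrt_majorant n"
proof (induction k)
  case (Suc k)
  have "norm (sqrt_iter B (Suc (n + k)) - sqrt_iter B n)
      \<le> norm (sqrt_iter B (Suc (n + k)) - sqrt_iter B (n + k)) + norm (sqrt_iter B (n + k) - sqrt_iter B n)"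
    by (metis norm_triangle_ineq diff_add_cancel add_diff_eq)
  with Suc norm_sqrt_iter_increment[OF assms, of "n + k"] show ?case
    unfolding add_Suc_right by linarith
qed simp

text \<open>The limit inherits every property that is closed in norm and preserved by the iteration; this is
  how symmetry, complex linearity and commutation relations pass to it.\<close>

lemma sqrt_fixed_point:
  fixes B :: "'a::banach \<Rightarrow>\<^sub>L 'a"
  assumes "norm B \<le> 1"
  obtains Y where "Y = (1/2) *\<^sub>R (B + (Y o\<^sub>L Y))"
    and "\<And>M. closed M \<Longrightarrow> 0 \<in> M \<Longrightarrow> (\<And>X. X \<in> M \<Longrightarrow> (1/2) *\<^sub>R (B + (X o\<^sub>L X)) \<in> M) \<Longrightarrow> Y \<in> M"
proof -
  have mono: "sqrt_majorant n \<le> sqrt_majorant (Suc n)" for n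
    using norm_sqrt_iter_increment[OF assms, of n] norm_ge_zero
    by (metis diff_ge_0_iff_ge order_trans)
  then have "incseq sqrt_majorant"
    by (rule incseq_SucI)
  then have "convergent sqrt_majorant"
    using sqrt_majorant_bounds by (meson incseq_convergent convergentI)
  then have cauchy: "Cauchy sqrt_majorant"
    by (rule convergent_Cauchy)
  have "Cauchy (sqrt_iter B)"
  proof (rule CauchyI')
    fix e :: real assume "0 < e"
    then obtain N where N: "\<And>m n. N \<le> m \<Longrightarrow> N \<le> n \<Longrightarrow> norm (sqrt_majorant m - sqrt_majorant n) < e"
      using CauchyD[OF cauchy] by blast
    have "norm (sqrt_iter B m - sqrt_iter B n) < e" if "N \<le> m" "m < n" for m n
    proof -
      have "norm (sqrt_iter B n - sqrt_iter B m) \<le> sqrt_majorant n - sqrt_majorant m"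
        using norm_sqrt_iter_diff[OF assms, of m "n - m"] that by simp
      also have "\<dots> < e"
        using N[of n m] that by (simp add: abs_less_iff)
      finally show ?thesis
        by (simp add: norm_minus_commute)
    qed
    then show "\<exists>M. \<forall>m\<ge>M. \<forall>n>m. dist (sqrt_iter B m) (sqrt_iter B n) < e"
      by (auto simp: dist_norm)
  qed
  then obtain Y where Y: "sqrt_iter B \<longlonglongrightarrow> Y"
    using Cauchy_convergent_iff convergent_def by blast
  have "(\<lambda>n. sqrt_iter B (Suc n)) \<longlonglongrightarrow> (1/2) *\<^sub>R (B + (Y o\<^sub>L Y))"
    unfolding sqrt_iter.simps
    by (intro tendsto_intros bounded_bilinear.tendsto[OF bounded_bilinear_blinfun_compose] Y)
  then have fixed: "Y = (1/2) *\<^sub>R (B + (Y o\<^sub>L Y))"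
    using LIMSEQ_unique LIMSEQ_Suc[OF Y] by blast
  have "Y \<in> M" if "closed M" "0 \<in> M" "\<And>X. X \<in> M \<Longrightarrow> (1/2) *\<^sub>R (B + (X o\<^sub>L X)) \<in> M" for M
  proof -
    have "sqrt_iter B n \<in> M" for n
      by (induction n) (simp_all add: that)
    then show ?thesis
      using closed_sequentially[OF that(1) _ Y] by blast
  qed
  with fixed show thesis
    using that by blast
qed

lemma closed_blinfun_symmetric:
  "closed {S :: 'a::real_inner \<Rightarrow>\<^sub>L 'a. \<forall>x y. inner (S x) y = inner x (S y)}"
  by (intro closed_Collect_all closed_Collect_eq continuous_intros)

lemma closed_blinfun_commute:
  "closed {S :: 'a::real_normed_vector \<Rightarrow>\<^sub>L 'a. S o\<^sub>L C = C o\<^sub>L S}"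
  by (intro closed_Collect_eq continuous_intros
      bounded_bilinear.continuous_on[OF bounded_bilinear_blinfun_compose])

lemma bounded_linear_scaleC: "bounded_linear (\<lambda>x::'a::complex_inner. c *\<^sub>C x)"
  by (rule bounded_linear_intro[where K = "cmod c"])
    (simp_all add: scaleC_add_right norm_scaleC scaleC_scaleC mult.commute
      flip: scaleC_complex_of_real)

lemma closed_bounded_ops: "closed (bounded_ops :: ('a::chilbert_space \<Rightarrow>\<^sub>L 'a) set)"
  unfolding bounded_ops_def
  by (intro closed_Collect_all closed_Collect_eq continuous_intros
      bounded_linear.continuous_on[OF bounded_linear_scaleC])

text \<open>Dividing by a number \<open>c > \<parallel>A\<parallel>\<close> reduces the claim to \<open>A/c = 1 - B\<close> with \<open>\<parallel>B\<parallel> \<le> 1\<close>, whose square root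
  is \<open>1 - Y\<close>. That the root commutes with the commutant of \<open>A\<close> is what its uniqueness rests on: any
  other square root of \<open>A\<close> commutes with \<open>A\<close>, hence with this one.\<close>

lemma positive_sqrt_exists:
  assumes A: "positive_op A"
  obtains S where "positive_op S" "S o\<^sub>L S = A" "\<And>C. A o\<^sub>L C = C o\<^sub>L A \<Longrightarrow> S o\<^sub>L C = C o\<^sub>L S"
proof -
  define c where "c = norm A + 1"
  have "0 < c" "norm A \<le> c"
    by (simp_all add: c_def add_nonneg_pos)
  define B where "B = id_blinfun - (1/c) *\<^sub>R A"
  have B_apply: "B x = x - (1/c) *\<^sub>R A x" for x
    by (simp add: B_def blinfun.bilinear_simps)
  have B_ops: "B (a *\<^sub>C x) = a *\<^sub>C B x" for a x
  proof -
    interpret a: bounded_linear "\<lambda>x. a *\<^sub>C x :: 'a" by (rule bounded_linear_scaleC)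
    show ?thesis
      using A by (simp add: B_apply positive_op_def bounded_opsD a.diff a.scaleR)
  qed
  have B_sym: "inner (B x) y = inner x (B y)" for x y
    by (simp add: B_apply inner_diff_left inner_diff_right positive_op_symmetric[OF A])
  have "norm B \<le> 1"
  proof (rule norm_blinfun_bound)
    fix x
    have "(norm (B x))\<^sup>2 = (norm x)\<^sup>2 - 2 * (inner (A x) x / c) + (norm (A x))\<^sup>2 / c\<^sup>2"
      unfolding power2_norm_eq_inner
      by (simp add: B_apply inner_diff_left inner_diff_right inner_commute algebra_simps power2_eq_square)
    also have "(norm (A x))\<^sup>2 / c\<^sup>2 \<le> inner (A x) x / c"
      using positive_op_norm_le[OF A \<open>norm A \<le> c\<close> \<open>0 < c\<close>, of x] \<open>0 < c\<close>
      by (simp add: field_simps power2_eq_square)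
    finally have "(norm (B x))\<^sup>2 \<le> (norm x)\<^sup>2"
      using positive_op_nonneg[OF A, of x] \<open>0 < c\<close> by (smt (verit) divide_nonneg_pos)
    then show "norm (B x) \<le> 1 * norm x"
      by (simp add: power2_le_iff_abs_le)
  qed simp
  then obtain Y where fixed: "Y = (1/2) *\<^sub>R (B + (Y o\<^sub>L Y))"
    and inherit: "\<And>M. closed M \<Longrightarrow> 0 \<in> M \<Longrightarrow> (\<And>X. X \<in> M \<Longrightarrow> (1/2) *\<^sub>R (B + (X o\<^sub>L X)) \<in> M) \<Longrightarrow> Y \<in> M"
    using sqrt_fixed_point by blast
  have Y_norm: "norm Y \<le> 1"
  proof -
    have "Y \<in> cball 0 1"
    proof (rule inherit)
      fix X :: "'a \<Rightarrow>\<^sub>L 'a" assume X: "X \<in> cball 0 1"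
      have "norm (X o\<^sub>L X) \<le> norm X * norm X"
        by (rule norm_blinfun_compose)
      also have "\<dots> \<le> 1"
        using X by (simp add: mult_le_one)
      finally show "(1/2) *\<^sub>R (B + (X o\<^sub>L X)) \<in> cball 0 1"
        using \<open>norm B \<le> 1\<close> norm_triangle_ineq[of B "X o\<^sub>L X"] by simp
    qed auto
    then show ?thesis by simp
  qed
  have Y_sym: "inner (Y x) y = inner x (Y y)" for x y
  proof -
    have "Y \<in> {S :: 'a \<Rightarrow>\<^sub>L 'a. \<forall>x y. inner (S x) y = inner x (S y)}"
      by (rule inherit[OF closed_blinfun_symmetric])
        (auto simp: blinfun.bilinear_simps inner_add_left inner_add_right B_sym)
    then show ?thesis by blast
  qed
  have Y_ops: "Y \<in> bounded_ops"
  proof (rule inherit[OF closed_bounded_ops])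
    have zero: "a *\<^sub>C (0::'a) = 0" for a
      by (rule linear_0[OF bounded_linear.linear[OF bounded_linear_scaleC]])
    then show "(0 :: 'a \<Rightarrow>\<^sub>L 'a) \<in> bounded_ops"
      by (simp add: bounded_ops_def)
    fix X :: "'a \<Rightarrow>\<^sub>L 'a" assume X: "X \<in> bounded_ops"
    have swap: "a *\<^sub>C (r *\<^sub>R x) = r *\<^sub>R (a *\<^sub>C x)" for a r and x :: 'a
      by (rule linear_scale[OF bounded_linear.linear[OF bounded_linear_scaleC]])
    show "(1/2) *\<^sub>R (B + (X o\<^sub>L X)) \<in> bounded_ops"
      by (auto simp: bounded_ops_def blinfun.bilinear_simps B_ops bounded_opsD[OF X] swap
          scaleC_add_right)
  qed
  have Y_comm: "Y o\<^sub>L C = C o\<^sub>L Y" if "A o\<^sub>L C = C o\<^sub>L A" for C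
  proof -
    have "A (C x) = C (A x)" for x
      using that by (metis blinfun_apply_blinfun_compose)
    then have BC: "B (C x) = C (B x)" for x
      by (simp add: B_apply blinfun.bilinear_simps)
    have "Y \<in> {S. S o\<^sub>L C = C o\<^sub>L S}"
    proof (rule inherit[OF closed_blinfun_commute]; clarsimp)
      fix X assume "X o\<^sub>L C = C o\<^sub>L X"
      then have "X (C x) = C (X x)" for x
        by (metis blinfun_apply_blinfun_compose)
      then show "((1/2) *\<^sub>R (B + (X o\<^sub>L X))) o\<^sub>L C = C o\<^sub>L ((1/2) *\<^sub>R (B + (X o\<^sub>L X)))"
        by (intro blinfun_eqI) (simp add: blinfun.bilinear_simps BC)
    qed
    then show ?thesis by simp
  qed
  define S where "S = sqrt c *\<^sub>R (id_blinfun - Y)"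
  have S_apply: "S x = sqrt c *\<^sub>R (x - Y x)" for x
    by (simp add: S_def blinfun.bilinear_simps)
  have "positive_op S"
  proof (rule positive_opI)
    show "S \<in> bounded_ops"
      unfolding bounded_ops_def
    proof safe
      fix a x
      interpret a: bounded_linear "\<lambda>x. a *\<^sub>C x :: 'a" by (rule bounded_linear_scaleC)
      show "S (a *\<^sub>C x) = a *\<^sub>C S x"
        by (simp add: S_apply bounded_opsD[OF Y_ops] a.diff a.scaleR)
    qed
    show "inner (S x) y = inner x (S y)" for x y
      by (simp add: S_apply inner_diff_left inner_diff_right Y_sym)
    show "0 \<le> inner (S x) x" for x
    proof -
      have "inner (Y x) x \<le> norm (Y x) * norm x"
        by (rule norm_cauchy_schwarz)
      also have "\<dots> \<le> (1 * norm x) * norm x"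
        using Y_norm by (intro mult_right_mono order_trans[OF norm_blinfun]) auto
      finally have "inner (Y x) x \<le> inner x x"
        by (simp flip: power2_norm_eq_inner power2_eq_square)
      then show ?thesis
        using \<open>0 < c\<close> by (simp add: S_apply inner_diff_left)
    qed
  qed
  moreover have "S o\<^sub>L S = A"
  proof (rule blinfun_eqI)
    fix x
    have "2 *\<^sub>R Y x = B x + Y (Y x)"
      by (subst fixed) (simp add: blinfun.bilinear_simps)
    then have "Y (Y x) = 2 *\<^sub>R Y x - B x"
      by simp
    then have "x - Y x - (Y x - Y (Y x)) = x - B x"
      by (simp add: scaleR_2)
    moreover have "(S o\<^sub>L S) x = c *\<^sub>R (x - Y x - (Y x - Y (Y x)))"
      using \<open>0 < c\<close> by (simp add: S_apply blinfun.diff_right blinfun.scaleR_right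
          flip: scaleR_diff_right)
    ultimately have "(S o\<^sub>L S) x = c *\<^sub>R (x - B x)"
      by simp
    then show "(S o\<^sub>L S) x = A x"
      using \<open>0 < c\<close> by (simp add: B_apply)
  qed
  moreover have "S o\<^sub>L C = C o\<^sub>L S" if "A o\<^sub>L C = C o\<^sub>L A" for C
  proof (rule blinfun_eqI)
    fix x
    have "Y (C x) = C (Y x)"
      using Y_comm[OF that] by (metis blinfun_apply_blinfun_compose)
    then show "(S o\<^sub>L C) x = (C o\<^sub>L S) x"
      by (simp add: S_apply blinfun.bilinear_simps)
  qed
  ultimately show thesis
    using that by blast
qed

text \<open>For commuting positive \<open>S\<close> and \<open>R\<close> with \<open>S\<^sup>2 = R\<^sup>2\<close>, the vector \<open>y = (S - R)x\<close> is annihilated by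
  \<open>S + R\<close>. As both summands are positive, \<open>Sy = Ry = 0\<close>, so that \<open>\<parallel>(S - R)x\<parallel>\<^sup>2 = \<langle>(S - R)y, x\<rangle> = 0\<close>.\<close>

lemma commuting_positive_sqrt_unique:
  assumes S: "positive_op S" and R: "positive_op R"
    and sq: "S o\<^sub>L S = R o\<^sub>L R" and comm: "S o\<^sub>L R = R o\<^sub>L S"
  shows "S = R"
proof (rule blinfun_eqI)
  fix x
  define y where "y = S x - R x"
  have "S (S x) = R (R x)" "S (R x) = R (S x)"
    using sq comm by (metis blinfun_apply_blinfun_compose)+
  then have "S y + R y = 0"
    by (simp add: y_def blinfun.diff_right)
  then have "inner (S y) y + inner (R y) y = 0"
    by (metis inner_add_left inner_zero_left)
  with positive_op_nonneg[OF S, of y] positive_op_nonneg[OF R, of y]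
  have "inner (S y) y = 0" "inner (R y) y = 0"
    by linarith+
  then have "S y = 0" "R y = 0"
    using positive_op_kernel S R by blast+
  have "inner y y = inner (S x) y - inner (R x) y"
    unfolding y_def by (simp add: inner_diff_left)
  also have "\<dots> = 0"
    by (simp add: positive_op_symmetric[OF S] positive_op_symmetric[OF R] \<open>S y = 0\<close> \<open>R y = 0\<close>)
  finally show "S x = R x"
    by (simp add: y_def)
qed

lemma op_square_op_sqrt:
  assumes "positive_op A"
  shows "op_square (op_sqrt A) = A"
proof -
  obtain S where S: "positive_op S" "S o\<^sub>L S = A"
    and comm: "\<And>C. A o\<^sub>L C = C o\<^sub>L A \<Longrightarrow> S o\<^sub>L C = C o\<^sub>L S"
    using positive_sqrt_exists[OF assms] by blast
  have "op_sqrt A = S"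
    unfolding op_sqrt_def
  proof (rule the_equality)
    fix R assume R: "positive_op R \<and> R o\<^sub>L R = A"
    have "A o\<^sub>L R = R o\<^sub>L A"
      using R by (metis blinfun_eqI blinfun_apply_blinfun_compose)
    then show "R = S"
      using commuting_positive_sqrt_unique[OF S(1)] R S(2) comm by metis
  qed (use S in blast)
  then show ?thesis
    by (simp add: op_square_def S)
qed

lemma op_square_op_abs:
  assumes T: "T \<in> bounded_ops"
  shows "op_square (op_abs T) = adj T o\<^sub>L T"
  unfolding op_abs_def
proof (rule op_square_op_sqrt)
  have "adj T o\<^sub>L T \<in> bounded_ops"
    using bounded_opsD[OF T] bounded_opsD[OF adj_in_bounded_ops[OF T]] by (simp add: bounded_ops_def)
  then show "positive_op (adj T o\<^sub>L T)"
    by (simp add: positive_op_def cinner_adj_left[OF T] cinner_self)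
qed

section \<open>Numerical radius\<close>

lemma cmod_quadratic_form_le:
  fixes T :: "'a::chilbert_space \<Rightarrow>\<^sub>L 'a"
  assumes "norm x = 1"
  shows "cmod (cinner (T x) x) \<le> norm T"
  using complex_Cauchy_Schwarz[of "T x" x] norm_blinfun[of T x] assms by simp

lemma numerical_radius_upper:
  fixes T :: "'a::chilbert_space \<Rightarrow>\<^sub>L 'a"
  assumes "norm x = 1"
  shows "cmod (cinner (T x) x) \<le> numerical_radius T"
  unfolding numerical_radius_def
proof (rule cSup_upper)
  show "bdd_above (insert 0 {cmod (cinner (T x) x) |x. norm x = 1})"
    by (rule bdd_aboveI[of _ "norm T"]) (auto simp: cmod_quadratic_form_le)
qed (use assms in blast)

lemma numerical_radius_least:
  fixes T :: "'a::chilbert_space \<Rightarrow>\<^sub>L 'a"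
  assumes "\<And>x. norm x = 1 \<Longrightarrow> cmod (cinner (T x) x) \<le> b" "0 \<le> b"
  shows "numerical_radius T \<le> b"
  unfolding numerical_radius_def using assms by (intro cSup_least) auto

lemma numerical_radius_nonneg: "0 \<le> numerical_radius (T :: 'a::chilbert_space \<Rightarrow>\<^sub>L 'a)"
  unfolding numerical_radius_def
  by (rule cSup_upper) (auto intro!: bdd_aboveI[of _ "norm T"] simp: cmod_quadratic_form_le)

lemma numerical_radius_square_least:
  fixes T :: "'a::chilbert_space \<Rightarrow>\<^sub>L 'a"
  assumes "\<And>x. norm x = 1 \<Longrightarrow> (cmod (cinner (T x) x))\<^sup>2 \<le> b" "0 \<le> b"
  shows "(numerical_radius T)\<^sup>2 \<le> b"
proof -
  have "numerical_radius T \<le> sqrt b"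
    using assms by (intro numerical_radius_least) (auto intro: real_le_rsqrt)
  then have "(numerical_radius T)\<^sup>2 \<le> (sqrt b)\<^sup>2"
    by (rule power_mono) (rule numerical_radius_nonneg)
  then show ?thesis
    using assms(2) by simp
qed

lemma Buzano_quadratic_form:
  fixes T :: "'a::chilbert_space \<Rightarrow>\<^sub>L 'a"
  assumes T: "T \<in> bounded_ops" and x: "norm x = 1"
  shows "(cmod (cinner (T x) x))\<^sup>2
    \<le> cmod (cinner (op_square T x) x) / 2 + ((norm (T x))\<^sup>2 + (norm (adj T x))\<^sup>2) / 4"
proof -
  have "2 * (cmod (cinner (T x) x))\<^sup>2 \<le> cmod (cinner (op_square T x) x) + norm (T x) * norm (adj T x)"
    using Buzano[OF x, of "T x" "adj T x"]
    by (simp add: cinner_adj[OF T, symmetric] op_square_def norm_mult power2_eq_square)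
  moreover have "2 * (norm (T x) * norm (adj T x)) \<le> (norm (T x))\<^sup>2 + (norm (adj T x))\<^sup>2"
    using sum_squares_bound[of "norm (T x)" "norm (adj T x)"] by simp
  ultimately show ?thesis
    by (simp add: field_simps)
qed

lemma Cauchy_Schwarz_quadratic_form:
  fixes T :: "'a::chilbert_space \<Rightarrow>\<^sub>L 'a"
  assumes T: "T \<in> bounded_ops" and x: "norm x = 1"
  shows "(cmod (cinner (T x) x))\<^sup>2 \<le> (norm (T x))\<^sup>2" "(cmod (cinner (T x) x))\<^sup>2 \<le> (norm (adj T x))\<^sup>2"
  using complex_Cauchy_Schwarz[of "T x" x] complex_Cauchy_Schwarz[of x "adj T x"] x
  by (simp_all add: cinner_adj[OF T] power_mono)

text \<open>The left-hand side is the value at \<open>x\<close> of the quadratic form of \<open>p |T|\<^sup>2 + q |T\<^sup>*|\<^sup>2\<close>, since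
  \<open>|T|\<^sup>2 = T\<^sup>*T\<close> and \<open>|T\<^sup>*|\<^sup>2 = TT\<^sup>*\<close>.\<close>

lemma combination_le_norm:
  fixes T :: "'a::chilbert_space \<Rightarrow>\<^sub>L 'a"
  assumes T: "T \<in> bounded_ops" and x: "norm x = 1"
  shows "p * (norm (T x))\<^sup>2 + q * (norm (adj T x))\<^sup>2
    \<le> norm (p *\<^sub>R op_square (op_abs T) + q *\<^sub>R op_square (op_abs (adj T)))" (is "_ \<le> norm ?A")
proof -
  have "inner (adj T (T x)) x = (norm (T x))\<^sup>2" "inner (T (adj T x)) x = (norm (adj T x))\<^sup>2"
    by (simp_all add: inner_eq_Re_cinner cinner_adj_left[OF T] cinner_adj[OF T] cinner_self)
  then have "p * (norm (T x))\<^sup>2 + q * (norm (adj T x))\<^sup>2 = inner (?A x) x"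
    by (simp add: op_square_op_abs T adj_in_bounded_ops adj_adj blinfun.bilinear_simps inner_add_left)
  also have "\<dots> \<le> norm (?A x) * norm x"
    by (rule norm_cauchy_schwarz)
  also have "\<dots> \<le> norm ?A"
    using norm_blinfun[of ?A x] x by simp
  finally show ?thesis .
qed

lemma numerical_radius_square_le:
  fixes T :: "'a::chilbert_space \<Rightarrow>\<^sub>L 'a"
  assumes T: "T \<in> bounded_ops" and \<alpha>: "0 \<le> \<alpha>"
    and bound: "\<And>x. norm x = 1 \<Longrightarrow> (cmod (cinner (T x) x))\<^sup>2
      \<le> \<alpha> / 2 * cmod (cinner (op_square T x) x) + (p * (norm (T x))\<^sup>2 + q * (norm (adj T x))\<^sup>2)"
  shows "(numerical_radius T)\<^sup>2 \<le> \<alpha> / 2 * numerical_radius (op_square T)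
    + norm (p *\<^sub>R op_square (op_abs T) + q *\<^sub>R op_square (op_abs (adj T)))"
proof (rule numerical_radius_square_least)
  fix x :: 'a assume x: "norm x = 1"
  have "\<alpha> / 2 * cmod (cinner (op_square T x) x) \<le> \<alpha> / 2 * numerical_radius (op_square T)"
    using \<alpha> by (intro mult_left_mono numerical_radius_upper x) simp
  then show "(cmod (cinner (T x) x))\<^sup>2 \<le> \<alpha> / 2 * numerical_radius (op_square T)
    + norm (p *\<^sub>R op_square (op_abs T) + q *\<^sub>R op_square (op_abs (adj T)))"
    using bound[OF x] combination_le_norm[OF T x, of p q] by linarith
qed (use \<alpha> numerical_radius_nonneg[of "op_square T"] in simp)

lemma convex_combination_bound:
  fixes s b c :: real
  assumes "s \<le> b" "s \<le> c" "0 \<le> \<alpha>" "\<alpha> \<le> 1"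
  shows "s \<le> \<alpha> * b + (1 - \<alpha>) * c"
  using convex_bound_le[of "- b" "- s" "- c" \<alpha> "1 - \<alpha>"] assms by simp

lemma numerical_radius_square_le_family1:
  fixes T :: "'a::chilbert_space \<Rightarrow>\<^sub>L 'a"
  assumes T: "T \<in> bounded_ops" and \<alpha>: "0 \<le> \<alpha>" "\<alpha> \<le> 1"
  shows "(numerical_radius T)\<^sup>2 \<le> \<alpha> / 2 * numerical_radius (op_square T)
    + norm ((\<alpha> / 4) *\<^sub>R op_square (op_abs T) + (1 - 3 / 4 * \<alpha>) *\<^sub>R op_square (op_abs (adj T)))"
proof (rule numerical_radius_square_le[OF T \<alpha>(1)])
  fix x :: 'a assume x: "norm x = 1"
  show "(cmod (cinner (T x) x))\<^sup>2 \<le> \<alpha> / 2 * cmod (cinner (op_square T x) x)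
      + (\<alpha> / 4 * (norm (T x))\<^sup>2 + (1 - 3 / 4 * \<alpha>) * (norm (adj T x))\<^sup>2)"
    using convex_combination_bound[OF Buzano_quadratic_form[OF T x]
        Cauchy_Schwarz_quadratic_form(2)[OF T x] \<alpha>]
    by (simp add: field_simps)
qed

lemma numerical_radius_square_le_family2:
  fixes T :: "'a::chilbert_space \<Rightarrow>\<^sub>L 'a"
  assumes T: "T \<in> bounded_ops" and \<alpha>: "0 \<le> \<alpha>" "\<alpha> \<le> 1"
  shows "(numerical_radius T)\<^sup>2 \<le> \<alpha> / 2 * numerical_radius (op_square T)
    + norm ((1 - 3 / 4 * \<alpha>) *\<^sub>R op_square (op_abs T) + (\<alpha> / 4) *\<^sub>R op_square (op_abs (adj T)))"
proof (rule numerical_radius_square_le[OF T \<alpha>(1)])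
  fix x :: 'a assume x: "norm x = 1"
  show "(cmod (cinner (T x) x))\<^sup>2 \<le> \<alpha> / 2 * cmod (cinner (op_square T x) x)
      + ((1 - 3 / 4 * \<alpha>) * (norm (T x))\<^sup>2 + \<alpha> / 4 * (norm (adj T x))\<^sup>2)"
    using convex_combination_bound[OF Buzano_quadratic_form[OF T x]
        Cauchy_Schwarz_quadratic_form(1)[OF T x] \<alpha>]
    by (simp add: field_simps)
qed

text \<open>Compactness makes \<open>LEAST\<close> a genuine value of \<open>f\<close>, to which a bound valid for every value applies.\<close>

lemma le_Least_image:
  fixes f :: "'a::topological_space \<Rightarrow> real"
  assumes "compact K" "K \<noteq> {}" "continuous_on K f" "\<And>a. a \<in> K \<Longrightarrow> w \<le> f a"
  shows "w \<le> (LEAST b. b \<in> f ` K)"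
proof -
  obtain a where a: "a \<in> K" "\<And>b. b \<in> K \<Longrightarrow> f a \<le> f b"
    using continuous_attains_inf[OF assms(1-3)] by blast
  have "(LEAST b. b \<in> f ` K) = f a"
    using a by (intro Least_equality) auto
  then show ?thesis
    using assms(4) a(1) by simp
qed

theorem corollary2p12:
  fixes T :: "'a::chilbert_space \<Rightarrow>\<^sub>L 'a"
  assumes "T \<in> bounded_ops"
  shows "(numerical_radius T)\<^sup>2 \<le> min (beta1 T) (beta2 T)"
proof (rule min.boundedI)
  show "(numerical_radius T)\<^sup>2 \<le> beta1 T"
    unfolding beta1_def
  proof (rule le_Least_image)
    fix \<alpha> :: real assume "\<alpha> \<in> {0..1}"
    then show "(numerical_radius T)\<^sup>2 \<le> \<alpha> / 2 * numerical_radius (op_square T)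
      + norm ((\<alpha> / 4) *\<^sub>R op_square (op_abs T) + (1 - 3 / 4 * \<alpha>) *\<^sub>R op_square (op_abs (adj T)))"
      by (intro numerical_radius_square_le_family1 assms) auto
  qed (auto intro!: continuous_intros)
  show "(numerical_radius T)\<^sup>2 \<le> beta2 T"
    unfolding beta2_def
  proof (rule le_Least_image)
    fix \<alpha> :: real assume "\<alpha> \<in> {0..1}"
    then show "(numerical_radius T)\<^sup>2 \<le> \<alpha> / 2 * numerical_radius (op_square T)
      + norm ((1 - 3 / 4 * \<alpha>) *\<^sub>R op_square (op_abs T) + (\<alpha> / 4) *\<^sub>R op_square (op_abs (adj T)))"
      by (intro numerical_radius_square_le_family2 assms) auto
  qed (auto intro!: continuous_intros)
qed

end
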